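(* Let $\varepsilon\in(0,2^{-10})$ and let $p=p(n)$ satisfy $(\log n)^{2+\varepsilon}n^{-1}\le p<n^{-\varepsilon}$. Let $G$ be an $n$-vertex $(\varepsilon,p)$-typical graph and $k=\varepsilon2^{-10}p^{-1}\log pn$. Then for all sufficiently large $n$ the following holds: with probability at least $1-n^{-2^{-11}\log pn}$, in the random greedy independent set process on $G$ we have \[ d_i(v)=(1\pm f_i)\widetilde d_i\qquad\text{for all } v\in V_i \text{ and all } i\in[k-1]. \]
   Context: All logarithms are natural; roundings are ignored; $[m]=\{1,\dots,m\}$; $x=a\pm b$ means $x\in[a-b,a+b]$. For $S\subseteq V(G)$, $N^c_G(S)=V(G)\setminus\bigcup_{w\in S}(\{w\}\cup N_G(w))$. Random greedy independent set process on $G$: choose $v_1$ uniformly from $V(G)$; for $i\ge2$ choose $v_i$ uniformly from $N^c_G(\{v_1,\dots,v_{i-1}\})$, stopping if it is empty. Set $V_0=V(G)$, $V_i=N^c_G(\{v_1,\dots,v_i\})$, $G_i=G[V_i]$, and for $v\in V_i$ let $d_i(v)$ be the degree of $v$ in $G_i$. Let $\widetilde d_i=(1-p)^ipn$, $f_0=4\log n\sqrt{\frac{\log pn}{pn}+p}$, $f_i=\big(\frac{1+16p}{1-p}\big)^i f_0$. An $n$-vertex graph $G$ is $(\varepsilon,p)$-typical if: (P1) for every $S\subseteq V(G)$ with $|S|\le\varepsilon p^{-1}\log pn$, $|N^c_G(S)|=(1\pm f_{|S|})(1-p)^{|S|}n$; (P2) every vertex $v$ has $d_G(v)=(1\pm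 f_0/2)pn$; (P3) all distinct $u,v$ have $|N_G(u)\cap N_G(v)|\le 4p^2n+2^7\log n$. *)

theory Defs
  imports "HOL-Probability.Probability" "Graph_Theory.Graph_Theory"
begin

text \<open>
  A finite simple graph is a \<open>G :: 'a pair_pre_digraph\<close> with \<open>pair_graph G\<close>: a finite vertex set
  \<open>pverts G\<close> and a symmetric, loop-free set \<open>parcs G\<close> of ordered pairs of vertices (each edge
  appears in both orientations, so the degree of a vertex is its out-degree).
\<close>

definition nbhd :: "'a pair_pre_digraph \<Rightarrow> 'a \<Rightarrow> 'a set" where
  "nbhd G v = {u. (v, u) \<in> parcs G}"

definition non_nbhd :: "'a pair_pre_digraph \<Rightarrow> 'a set \<Rightarrow> 'a set" where
  "non_nbhd G S = pverts G - (\<Union>w\<in>S. {w} \<union> nbhd G w)"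

definition degree_in :: "'a pair_pre_digraph \<Rightarrow> 'a set \<Rightarrow> 'a \<Rightarrow> nat" where
  "degree_in G S v = out_degree (with_proj G \<restriction> S) v"

definition d_tilde :: "nat \<Rightarrow> real \<Rightarrow> nat \<Rightarrow> real" where
  "d_tilde n p i = (1 - p) ^ i * p * real n"

definition f_err :: "nat \<Rightarrow> real \<Rightarrow> nat \<Rightarrow> real" where
  "f_err n p i = ((1 + 16 * p) / (1 - p)) ^ i *
     (4 * ln (real n) * sqrt (ln (p * real n) / (p * real n) + p))"

definition typical :: "real \<Rightarrow> real \<Rightarrow> 'a pair_pre_digraph \<Rightarrow> bool" where
  "typical \<epsilon> p G \<longleftrightarrow>
    (let n = card (pverts G) in
      (\<forall>S \<subseteq> pverts G. real (card S) \<le> \<epsilon> * inverse p * ln (p * real n) \<longrightarrow>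
         real (card (non_nbhd G S)) \<in>
           {(1 - f_err n p (card S)) * ((1 - p) ^ card S * real n) ..
            (1 + f_err n p (card S)) * ((1 - p) ^ card S * real n)}) \<and>
      (\<forall>v \<in> pverts G. real (out_degree (with_proj G) v) \<in>
         {(1 - f_err n p 0 / 2) * (p * real n) .. (1 + f_err n p 0 / 2) * (p * real n)}) \<and>
      (\<forall>u \<in> pverts G. \<forall>v \<in> pverts G. u \<noteq> v \<longrightarrow>
         real (card (nbhd G u \<inter> nbhd G v)) \<le> 4 * p\<^sup>2 * real n + 2 ^ 7 * ln (real n)))"

text \<open>
  The state of the random greedy independent set process is the list \<open>[v\<^sub>1, \<dots>, v\<^sub>i]\<close> of vertices
  chosen so far; once no vertex is available the state no longer changes.
\<close>

definition greedy_step :: "'a pair_pre_digraph \<Rightarrow> 'a list \<Rightarrow> 'a list pmf" where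
  "greedy_step G vs =
    (if non_nbhd G (set vs) = {} then return_pmf vs
     else map_pmf (\<lambda>v. vs @ [v]) (pmf_of_set (non_nbhd G (set vs))))"

primrec greedy_run :: "'a pair_pre_digraph \<Rightarrow> nat \<Rightarrow> 'a list pmf" where
  "greedy_run G 0 = return_pmf []"
| "greedy_run G (Suc i) = bind_pmf (greedy_run G i) (greedy_step G)"

text \<open>
  Every step before the process stops uses up a vertex, so after \<open>card (pverts G)\<close> steps it has
  stopped (lemma \<open>greedy_process_stopped\<close>): this is the law of the complete sequence of choices.
\<close>

definition greedy_process :: "'a pair_pre_digraph \<Rightarrow> 'a list pmf" where
  "greedy_process G = greedy_run G (card (pverts G))"

text \<open>
  \<open>V\<^sub>i\<close> for the sequence of choices \<open>vs\<close>.  If the process stops before step \<open>i\<close>, then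
  \<open>take i vs = vs\<close> and this set is empty.
\<close>

definition avail :: "'a pair_pre_digraph \<Rightarrow> 'a list \<Rightarrow> nat \<Rightarrow> 'a set" where
  "avail G vs i = non_nbhd G (set (take i vs))"

lemma greedy_run_invariant:
  assumes "finite (pverts G)" "vs \<in> set_pmf (greedy_run G i)"
  shows "set vs \<subseteq> pverts G \<and> distinct vs \<and> (non_nbhd G (set vs) = {} \<or> length vs = i)"
  using assms(2)
proof (induction i arbitrary: vs)
  case 0
  then show ?case by simp
next
  case (Suc i)
  then obtain us where us: "us \<in> set_pmf (greedy_run G i)" "vs \<in> set_pmf (greedy_step G us)"
    by auto
  show ?case
  proof (cases "non_nbhd G (set us) = {}")
    case True
    then show ?thesis using us Suc.IH[OF us(1)] by (simp add: greedy_step_def)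
  next
    case False
    have "finite (non_nbhd G (set us))" using assms(1) by (simp add: non_nbhd_def)
    with False us(2) obtain v where "v \<in> non_nbhd G (set us)" "vs = us @ [v]"
      by (auto simp: greedy_step_def)
    then show ?thesis using False Suc.IH[OF us(1)] by (auto simp: non_nbhd_def)
  qed
qed

lemma greedy_process_stopped:
  assumes "finite (pverts G)" "vs \<in> set_pmf (greedy_process G)"
  shows "non_nbhd G (set vs) = {}"
proof (rule ccontr)
  assume ne: "non_nbhd G (set vs) \<noteq> {}"
  have *: "set vs \<subseteq> pverts G" "distinct vs" "length vs = card (pverts G)"
    using greedy_run_invariant[OF assms(1)] assms(2) ne by (auto simp: greedy_process_def)
  then have "set vs = pverts G"
    using assms(1) by (metis card_subset_eq distinct_card)
  with ne show False by (auto simp: non_nbhd_def)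
qed

end

theory Submission
  imports Defs "HOL-Real_Asymp.Real_Asymp"
begin

text \<open>
  Fix a vertex \<open>v\<close> and consider the rescaled degree \<open>d\<^sub>i(v) / (1 - p)\<^sup>i\<close>.  As long as all
  degrees are in their windows, the expected loss of \<open>d\<^sub>i(v)\<close> in one step is
  \<open>(1 \<plusminus> 4 f\<^sub>i) p d\<^sub>i(v)\<close>: it is a sum of degrees over the neighbours of \<open>v\<close>, divided by
  \<open>|V\<^sub>i|\<close>.  The windows, rescaled in the same way, widen by \<open>17 p f\<^sub>i / (1 - p)\<close> times \<open>pn\<close>,
  which leaves a drift towards the inside.  The loss in one step is at most the codegree bound
  \<open>C = 4 p\<^sup>2 n + 2\<^sup>7 log n\<close>, so with \<open>h = f\<^sub>0 / C\<close> this drift outweighs the second-order term of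
  the exponential moment, and \<open>exp (h (d\<^sub>i(v) / (1 - p)\<^sup>i - (1 + f\<^sub>i) pn))\<close> is a supermartingale
  until something fails; likewise for the lower bound.  It starts below
  \<open>exp (- h f\<^sub>0 pn / 2) \<le> exp (- (log n log pn) / 16)\<close> and exceeds \<open>1\<close> when \<open>v\<close> leaves its
  window, which is enough for a union bound over times and vertices.
\<close>

section \<open>Degrees and codegrees\<close>

definition codegree_in :: "'a pair_pre_digraph \<Rightarrow> 'a set \<Rightarrow> 'a \<Rightarrow> 'a \<Rightarrow> nat" where
  "codegree_in G S u v = card (nbhd G u \<inter> nbhd G v \<inter> S)"

definition mean_codegree_in :: "'a pair_pre_digraph \<Rightarrow> 'a set \<Rightarrow> 'a \<Rightarrow> real" where
  "mean_codegree_in G S v = (\<Sum>u\<in>S - {v}. real (codegree_in G S u v)) / real (card S)"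

lemma finite_non_nbhd: "finite (pverts G) \<Longrightarrow> finite (non_nbhd G S)"
  by (simp add: non_nbhd_def)

lemma non_nbhd_insert: "non_nbhd G (insert u S) = non_nbhd G S - insert u (nbhd G u)"
  by (auto simp: non_nbhd_def)

lemma avail_subset_pverts: "avail G vs i \<subseteq> pverts G"
  by (auto simp: avail_def non_nbhd_def)

context pair_graph
begin

lemma nbhd_sym: "u \<in> nbhd G v \<longleftrightarrow> v \<in> nbhd G u"
  using pair_sym_arcs by (auto simp: nbhd_def symmetric_def sym_def)

lemma nbhd_subset_pverts: "nbhd G v \<subseteq> pverts G"
  using in_arcsD2 by (auto simp: nbhd_def)

lemma finite_nbhd: "finite (nbhd G v)"
  using nbhd_subset_pverts pair_finite_verts by (rule finite_subset)

lemma out_degree_eq_card_nbhd: "out_degree (with_proj G) v = card (nbhd G v)"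
proof -
  have "out_arcs (with_proj G) v = Pair v ` nbhd G v"
    by (auto simp: out_arcs_def nbhd_def)
  then show ?thesis
    by (simp add: out_degree_def card_image inj_on_def)
qed

lemma degree_in_eq_card:
  assumes "v \<in> S"
  shows "degree_in G S v = card (nbhd G v \<inter> S)"
proof -
  have "out_arcs (with_proj G \<restriction> S) v = Pair v ` (nbhd G v \<inter> S)"
    using assms by (auto simp: out_arcs_def nbhd_def induce_subgraph_def)
  then show ?thesis
    by (simp add: degree_in_def out_degree_def card_image inj_on_def)
qed

lemma codegree_in_le: "codegree_in G S u v \<le> card (nbhd G u \<inter> nbhd G v)"
  by (auto simp: codegree_in_def finite_nbhd intro!: card_mono)

lemma degree_in_non_nbhd_insert:
  assumes "v \<in> non_nbhd G (insert u S)"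
  shows "degree_in G (non_nbhd G S) v =
    codegree_in G (non_nbhd G S) u v + degree_in G (non_nbhd G (insert u S)) v"
proof -
  let ?N = "nbhd G v \<inter> non_nbhd G S"
  have v: "v \<in> non_nbhd G S" and "u \<notin> nbhd G v"
    using assms nbhd_sym[of u v] by (auto simp: non_nbhd_insert)
  have "card ?N = card (?N \<inter> nbhd G u) + card (?N - nbhd G u)"
    by (intro card_Int_Diff finite_Int) (simp add: finite_nbhd)
  also have "?N \<inter> nbhd G u = nbhd G u \<inter> nbhd G v \<inter> non_nbhd G S"
    by blast
  also have "?N - nbhd G u = nbhd G v \<inter> non_nbhd G (insert u S)"
    using \<open>u \<notin> nbhd G v\<close> by (auto simp: non_nbhd_insert)
  finally show ?thesis
    using v assms by (simp add: degree_in_eq_card codegree_in_def)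
qed

lemma sum_codegree_in:
  assumes "finite S" "v \<in> S"
  shows "(\<Sum>u\<in>S - {v}. codegree_in G S u v) = (\<Sum>w\<in>nbhd G v \<inter> S. degree_in G S w - 1)"
proof -
  have "card {u \<in> S - {v}. w \<in> nbhd G u} = degree_in G S w - 1" if "w \<in> nbhd G v \<inter> S" for w
  proof -
    have "{u \<in> S - {v}. w \<in> nbhd G u} = (nbhd G w \<inter> S) - {v}"
      using nbhd_sym[of w] by blast
    moreover have "v \<in> nbhd G w \<inter> S"
      using that assms(2) nbhd_sym[of v w] by blast
    ultimately show ?thesis
      using that by (simp add: degree_in_eq_card)
  qed
  then have "(\<Sum>u\<in>S - {v}. card {w \<in> nbhd G v \<inter> S. w \<in> nbhd G u}) =
      (\<Sum>w\<in>nbhd G v \<inter> S. degree_in G S w - 1)"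
    using assms(1) by (intro sum_multicount_gen) auto
  then show ?thesis
    by (simp add: codegree_in_def Int_def conj_ac)
qed

end

section \<open>Supermartingales along the greedy process\<close>

lemma length_greedy_run_le:
  assumes "finite (pverts G)" "vs \<in> set_pmf (greedy_run G i)"
  shows "length vs \<le> i"
  using assms(2)
proof (induction i arbitrary: vs)
  case (Suc i)
  then obtain us where us: "us \<in> set_pmf (greedy_run G i)" "vs \<in> set_pmf (greedy_step G us)"
    by auto
  then have "length vs \<le> Suc (length us)"
    using finite_non_nbhd[OF assms(1)] by (auto simp: greedy_step_def split: if_splits)
  then show ?case
    using Suc.IH[OF us(1)] by simp
qed simp

lemma map_take_greedy_run:
  assumes "finite (pverts G)" "i \<le> j"
  shows "map_pmf (take i) (greedy_run G j) = greedy_run G i"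
  using assms(2)
proof (induction j rule: dec_induct)
  case base
  have "map_pmf (take i) (greedy_run G i) = map_pmf (\<lambda>vs. vs) (greedy_run G i)"
    using length_greedy_run_le[OF assms(1)] by (intro map_pmf_cong) auto
  then show ?case by simp
next
  case (step j)
  have "map_pmf (take i) (greedy_step G vs) = return_pmf (take i vs)"
    if "vs \<in> set_pmf (greedy_run G j)" for vs
    using greedy_run_invariant[OF assms(1) that] step(1)
    by (auto simp: greedy_step_def pmf.map_comp o_def)
  then have "map_pmf (take i) (greedy_run G (Suc j)) =
      bind_pmf (greedy_run G j) (\<lambda>vs. return_pmf (take i vs))"
    by (auto simp: map_bind_pmf intro: bind_pmf_cong)
  also have "\<dots> = greedy_run G i"
    using step.IH by (simp add: map_pmf_def)
  finally show ?case .
qed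

lemma nn_integral_greedy_step_le:
  fixes g :: "'a list \<Rightarrow> real"
  assumes fin: "finite (pverts G)" and nonneg: "\<And>us. 0 \<le> g us"
    and stopped: "non_nbhd G (set vs) = {} \<Longrightarrow> g vs \<le> b"
    and chosen: "(\<Sum>u\<in>non_nbhd G (set vs). g (vs @ [u])) \<le> real (card (non_nbhd G (set vs))) * b"
  shows "(\<integral>\<^sup>+us. ennreal (g us) \<partial>greedy_step G vs) \<le> ennreal b"
proof (cases "non_nbhd G (set vs) = {}")
  case True
  then show ?thesis
    using stopped by (simp add: greedy_step_def ennreal_leI)
next
  case False
  let ?V = "non_nbhd G (set vs)"
  have V: "finite ?V" "0 < real (card ?V)"
    using False finite_non_nbhd[OF fin] by (auto simp: card_gt_0_iff)
  have "(\<integral>\<^sup>+us. ennreal (g us) \<partial>greedy_step G vs) =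
      (\<Sum>u\<in>?V. ennreal (g (vs @ [u]))) / ennreal (real (card ?V))"
    using False V
    by (simp add: greedy_step_def nn_integral_pmf_of_set ennreal_of_nat_eq_real_of_nat)
  also have "\<dots> = ennreal ((\<Sum>u\<in>?V. g (vs @ [u])) / real (card ?V))"
    using V nonneg by (simp add: sum_ennreal divide_ennreal sum_nonneg)
  also have "\<dots> \<le> ennreal b"
    using chosen V by (intro ennreal_leI) (simp add: pos_divide_le_eq mult.commute)
  finally show ?thesis .
qed

lemma nn_integral_greedy_run_le:
  fixes \<Phi> :: "nat \<Rightarrow> 'a list \<Rightarrow> ennreal"
  assumes "\<And>j vs. j < i \<Longrightarrow> vs \<in> set_pmf (greedy_run G j) \<Longrightarrow>
    (\<integral>\<^sup>+us. \<Phi> (Suc j) us \<partial>greedy_step G vs) \<le> \<Phi> j vs"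
  shows "(\<integral>\<^sup>+vs. \<Phi> i vs \<partial>greedy_run G i) \<le> \<Phi> 0 []"
  using assms
proof (induction i)
  case (Suc i)
  have "(\<integral>\<^sup>+vs. \<Phi> (Suc i) vs \<partial>greedy_run G (Suc i)) \<le> (\<integral>\<^sup>+vs. \<Phi> i vs \<partial>greedy_run G i)"
    using Suc.prems by (auto simp: AE_measure_pmf_iff intro!: nn_integral_mono_AE)
  also have "\<dots> \<le> \<Phi> 0 []"
    using Suc by simp
  finally show ?case .
qed simp

lemma prob_greedy_run_le_initial:
  fixes \<Phi> :: "nat \<Rightarrow> 'a list \<Rightarrow> real"
  assumes fin: "finite (pverts G)" and nonneg: "\<And>j vs. 0 \<le> \<Phi> j vs"
    and stopped: "\<And>j vs. j < i \<Longrightarrow> vs \<in> set_pmf (greedy_run G j) \<Longrightarrow>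
      non_nbhd G (set vs) = {} \<Longrightarrow> \<Phi> (Suc j) vs \<le> \<Phi> j vs"
    and chosen: "\<And>j vs. j < i \<Longrightarrow> vs \<in> set_pmf (greedy_run G j) \<Longrightarrow>
      (\<Sum>u\<in>non_nbhd G (set vs). \<Phi> (Suc j) (vs @ [u])) \<le> real (card (non_nbhd G (set vs))) * \<Phi> j vs"
    and ge_one: "\<And>vs. vs \<in> A \<Longrightarrow> 1 \<le> \<Phi> i vs"
  shows "measure_pmf.prob (greedy_run G i) A \<le> \<Phi> 0 []"
proof -
  have "emeasure (greedy_run G i) A = (\<integral>\<^sup>+vs. indicator A vs \<partial>greedy_run G i)"
    by simp
  also have "\<dots> \<le> (\<integral>\<^sup>+vs. ennreal (\<Phi> i vs) \<partial>greedy_run G i)"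
    using ge_one by (intro nn_integral_mono) (auto simp: indicator_def)
  also have "\<dots> \<le> ennreal (\<Phi> 0 [])"
    using fin nonneg stopped chosen
    by (intro nn_integral_greedy_run_le nn_integral_greedy_step_le)
  finally show ?thesis
    using nonneg by (simp add: measure_pmf.emeasure_eq_measure)
qed

section \<open>Real inequalities\<close>

lemma exp_le_quadratic:
  fixes x :: real
  assumes "x \<le> 1"
  shows "exp x \<le> 1 + x + x\<^sup>2"
proof (cases "0 \<le> x")
  case True
  then show ?thesis using exp_bound assms by simp
next
  case False
  have "1 \<le> (1 + x + x\<^sup>2) * (1 + (- x))"
    using False by (simp add: algebra_simps power2_eq_square mult_le_0_iff)
  also have "\<dots> \<le> (1 + x + x\<^sup>2) * exp (- x)"
  proof (rule mult_left_mono)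
    have "0 \<le> (x + 1 / 2)\<^sup>2 + 3 / 4" by simp
    also have "\<dots> = 1 + x + x\<^sup>2" by (simp add: power2_sum power_divide)
    finally show "0 \<le> 1 + x + x\<^sup>2" .
  qed (rule exp_ge_add_one_self)
  finally show ?thesis
    by (simp add: exp_minus field_simps)
qed

lemma sum_exp_diff_le_card:
  fixes x :: "'a \<Rightarrow> real"
  assumes "finite V" "W \<subseteq> V" and le_1: "\<And>u. u \<in> W \<Longrightarrow> x u \<le> 1"
    and moments: "(\<Sum>u\<in>W. x u + (x u)\<^sup>2) \<le> real (card V) * a"
  shows "(\<Sum>u\<in>W. exp (x u - a)) \<le> real (card V)"
proof -
  have "(\<Sum>u\<in>W. exp (x u)) \<le> (\<Sum>u\<in>W. 1 + (x u + (x u)\<^sup>2))"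
    using exp_le_quadratic[OF le_1] by (intro sum_mono) (simp add: add.assoc)
  also have "\<dots> \<le> real (card V) * (1 + a)"
    using card_mono[OF assms(1,2)] moments by (simp add: sum.distrib algebra_simps)
  also have "\<dots> \<le> real (card V) * exp a"
    by (intro mult_left_mono exp_ge_add_one_self) simp
  finally show ?thesis
    by (simp add: exp_diff sum_divide_distrib[symmetric] divide_le_eq)
qed

lemma sum_exp_tilted_le_card:
  fixes c :: "'a \<Rightarrow> real" and s H a b :: real
  assumes V: "finite V" "W \<subseteq> V" and s: "\<bar>s\<bar> = 1" and H: "0 \<le> H" and "b \<le> 1"
    and c: "\<And>u. u \<in> W \<Longrightarrow> 0 \<le> c u" "\<And>u. u \<in> W \<Longrightarrow> H * c u \<le> b"
    and drift: "(b - s) * (\<Sum>u\<in>W. c u) \<le> real (card V) * a"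
  shows "(\<Sum>u\<in>W. exp (H * (- s * c u - a))) \<le> real (card V)"
proof -
  define x where "x u = - s * H * c u" for u
  have abs_x: "\<bar>x u\<bar> = H * c u" if "u \<in> W" for u
    using s H c(1)[OF that] by (simp add: x_def abs_mult)
  have "(\<Sum>u\<in>W. exp (x u - H * a)) \<le> real (card V)"
  proof (rule sum_exp_diff_le_card[OF V])
    show "x u \<le> 1" if "u \<in> W" for u
      using abs_x[OF that] c(2)[OF that] \<open>b \<le> 1\<close> by linarith
    have "(\<Sum>u\<in>W. x u + (x u)\<^sup>2) \<le> (\<Sum>u\<in>W. H * (b - s) * c u)"
    proof (rule sum_mono)
      fix u assume u: "u \<in> W"
      have "(x u)\<^sup>2 = (H * c u) * (H * c u)"
        using abs_x[OF u] by (metis power2_abs power2_eq_square)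
      also have "\<dots> \<le> b * (H * c u)"
        using c[OF u] H by (intro mult_right_mono) auto
      finally show "x u + (x u)\<^sup>2 \<le> H * (b - s) * c u"
        by (simp add: x_def algebra_simps)
    qed
    also have "\<dots> = H * ((b - s) * (\<Sum>u\<in>W. c u))"
      by (simp add: mult.assoc flip: sum_distrib_left)
    also have "\<dots> \<le> H * (real (card V) * a)"
      using drift H by (rule mult_left_mono)
    finally show "(\<Sum>u\<in>W. x u + (x u)\<^sup>2) \<le> real (card V) * (H * a)"
      by (simp add: mult_ac)
  qed
  then show ?thesis
    by (simp add: x_def algebra_simps)
qed

lemma quotient_rel_error_le:
  fixes a b m t \<alpha> \<beta> :: real
  assumes "0 \<le> a" "0 < b" "0 \<le> \<alpha>" "0 \<le> \<beta>" "\<beta> < 1"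
    and t: "\<bar>t - a\<bar> \<le> \<alpha> * a" and m: "\<bar>m - b\<bar> \<le> \<beta> * b"
  shows "\<bar>t / m - a / b\<bar> \<le> (\<alpha> + \<beta>) / (1 - \<beta>) * (a / b)"
proof -
  have m_ge: "(1 - \<beta>) * b \<le> m"
    using m by (simp add: abs_le_iff algebra_simps)
  moreover have "0 < (1 - \<beta>) * b"
    using assms by simp
  ultimately have m_pos: "0 < m" by linarith
  have "t / m - a / b = ((t - a) * b - a * (m - b)) / (m * b)"
    using m_pos assms(2) by (simp add: field_simps)
  then have "\<bar>t / m - a / b\<bar> = \<bar>(t - a) * b - a * (m - b)\<bar> / (m * b)"
    using m_pos assms(2) by (simp add: abs_mult)
  also have "\<dots> \<le> (\<alpha> + \<beta>) * (a * b) / (m * b)"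
  proof (rule divide_right_mono)
    have "\<bar>(t - a) * b - a * (m - b)\<bar> \<le> \<bar>t - a\<bar> * b + a * \<bar>m - b\<bar>"
      using abs_triangle_ineq4[of "(t - a) * b" "a * (m - b)"] assms(1,2) by (simp add: abs_mult)
    also have "\<dots> \<le> \<alpha> * a * b + a * (\<beta> * b)"
      using t m assms(1,2) by (intro add_mono mult_right_mono mult_left_mono) auto
    finally show "\<bar>(t - a) * b - a * (m - b)\<bar> \<le> (\<alpha> + \<beta>) * (a * b)"
      by (simp add: algebra_simps)
  qed (use m_pos assms(2) in simp)
  also have "\<dots> \<le> (\<alpha> + \<beta>) * (a * b) / ((1 - \<beta>) * b * b)"
    using m_ge m_pos assms by (intro divide_left_mono mult_right_mono) auto
  also have "\<dots> = (\<alpha> + \<beta>) / (1 - \<beta>) * (a / b)"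
    using assms(2) by simp
  finally show ?thesis .
qed

lemma abs_sum_diff_const_le:
  fixes g :: "'a \<Rightarrow> real"
  assumes "\<And>x. x \<in> A \<Longrightarrow> \<bar>g x - a\<bar> \<le> e"
  shows "\<bar>(\<Sum>x\<in>A. g x) - real (card A) * a\<bar> \<le> real (card A) * e"
proof -
  have "(\<Sum>x\<in>A. g x) - real (card A) * a = (\<Sum>x\<in>A. g x - a)"
    by (simp add: sum_subtractf)
  also have "\<bar>\<dots>\<bar> \<le> (\<Sum>x\<in>A. \<bar>g x - a\<bar>)"
    by (rule sum_abs)
  also have "\<dots> \<le> real (card A) * e"
    using assms by (rule sum_bounded_above)
  finally show ?thesis .
qed

lemma mem_rel_interval_iff:
  fixes x d e :: real
  shows "x \<in> {(1 - e) * d..(1 + e) * d} \<longleftrightarrow> \<bar>x - d\<bar> \<le> e * d"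
  by (auto simp: abs_le_iff algebra_simps)

section \<open>Typical graphs\<close>

lemma f_err_Suc: "f_err n p (Suc i) = (1 + 16 * p) / (1 - p) * f_err n p i"
  by (simp add: f_err_def)

locale typical_process = pair_graph G for G :: "'a pair_pre_digraph" +
  fixes \<epsilon> p k :: real
  assumes typical: "typical \<epsilon> p G"
    and eps_le: "\<epsilon> \<le> 1"
    and p_pos: "0 < p" and p_le: "p \<le> 1 / 100"
    and ln_pn_ge: "1 \<le> ln (p * real (card (pverts G)))"
    and k_le: "k \<le> \<epsilon> * inverse p * ln (p * real (card (pverts G)))"
    and f_err_le: "\<And>i. real i \<le> k \<Longrightarrow> f_err (card (pverts G)) p i \<le> 1 / 20"
begin

abbreviation n :: nat where "n \<equiv> card (pverts G)"
abbreviation f :: "nat \<Rightarrow> real" where "f \<equiv> f_err n p"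
abbreviation d :: "nat \<Rightarrow> real" where "d \<equiv> d_tilde n p"

lemma pn_gt_one: "1 < p * real n"
proof -
  have "p * real n \<noteq> 0"
    using ln_pn_ge by auto
  moreover have "0 \<le> p * real n"
    using p_pos by simp
  ultimately have "0 < p * real n"
    by linarith
  then show ?thesis
    using ln_pn_ge ln_gt_zero_iff[of "p * real n"] by linarith
qed

lemma n_pos: "0 < n"
  using pn_gt_one by (cases "n = 0") auto

lemma ln_pn_le_ln_n: "ln (p * real n) \<le> ln (real n)"
proof -
  have "p * real n \<le> 1 * real n" using p_le by (intro mult_right_mono) auto
  then show ?thesis using pn_gt_one n_pos by simp
qed

lemma ln_n_ge: "1 \<le> ln (real n)"
  using ln_pn_le_ln_n ln_pn_ge by simp

lemma k_le_n: "k \<le> real n"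
proof -
  have "k \<le> 1 * (inverse p * ln (p * real n))"
    using k_le eps_le p_pos ln_pn_ge
    by (elim order_trans) (simp only: mult.assoc, intro mult_right_mono, auto)
  also have "\<dots> \<le> inverse p * (p * real n)"
    using p_pos pn_gt_one by (simp add: less_imp_le[OF ln_less_self])
  finally show ?thesis using p_pos by (simp add: field_simps)
qed

lemma d_pos: "0 < d i"
  using p_pos p_le n_pos by (simp add: d_tilde_def)

lemma f_0_pos: "0 < f 0"
  using ln_n_ge ln_pn_ge pn_gt_one p_pos by (simp add: f_err_def add_nonneg_pos)

lemma f_pos: "0 < f i"
  using f_0_pos p_pos p_le by (simp add: f_err_def)

lemma f_0_le: "f 0 \<le> f i * (1 - p) ^ i"
proof -
  have "f 0 * 1 \<le> f 0 * (1 + 16 * p) ^ i"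
    using f_0_pos p_pos by (intro mult_left_mono one_le_power) auto
  also have "\<dots> = f i * (1 - p) ^ i"
    using p_le by (simp add: f_err_def power_divide)
  finally show ?thesis by simp
qed

lemma f_0_squared_mult_pn:
  "(f 0)\<^sup>2 * (p * real n) = 16 * (ln (real n))\<^sup>2 * (ln (p * real n) + p\<^sup>2 * real n)"
proof -
  have "0 \<le> ln (p * real n) / (p * real n) + p"
    using pn_gt_one ln_pn_ge p_pos by simp
  then have "(f 0)\<^sup>2 * (p * real n) =
      16 * (ln (real n))\<^sup>2 * ((ln (p * real n) / (p * real n) + p) * (p * real n))"
    by (simp add: f_err_def power_mult_distrib)
  also have "(ln (p * real n) / (p * real n) + p) * (p * real n) = ln (p * real n) + p\<^sup>2 * real n"
    using p_pos n_pos by (simp add: field_simps power2_eq_square)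
  finally show ?thesis .
qed

lemma f_d_ge_one: "1 \<le> f i * d i"
proof -
  have "1 \<le> 16 * (ln (real n))\<^sup>2 * (ln (p * real n) + p\<^sup>2 * real n) * (p * real n)"
    using ln_n_ge ln_pn_ge
    by (intro mult_ge1_I[OF _ less_imp_le[OF pn_gt_one]] mult_ge1_I) (auto simp: add_increasing2)
  also have "\<dots> = (f 0 * (p * real n))\<^sup>2"
    unfolding f_0_squared_mult_pn[symmetric] by (simp add: power2_eq_square)
  finally have "1\<^sup>2 \<le> (f 0 * (p * real n))\<^sup>2"
    by simp
  then have "1 \<le> f 0 * (p * real n)"
    by (rule power2_le_imp_le) (use f_0_pos p_pos in simp)
  also have "\<dots> \<le> f i * (1 - p) ^ i * (p * real n)"
    using f_0_le p_pos by (intro mult_right_mono) auto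
  finally show ?thesis
    by (simp add: d_tilde_def mult_ac)
qed

definition codegree_bound :: real where
  "codegree_bound = 4 * p\<^sup>2 * real n + 2 ^ 7 * ln (real n)"

definition tilt :: real where
  "tilt = f 0 / codegree_bound"

lemma codegree_bound_pos: "0 < codegree_bound"
  using p_pos ln_n_ge by (auto simp: codegree_bound_def intro!: add_nonneg_pos)

lemma tilt_pos: "0 < tilt"
  using f_0_pos codegree_bound_pos by (simp add: tilt_def)

lemma tilt_codegree_bound_le: "tilt / (1 - p) ^ Suc i * codegree_bound \<le> f i / (1 - p)"
proof -
  have "tilt / (1 - p) ^ Suc i * codegree_bound = f 0 / (1 - p) ^ i / (1 - p)"
    using codegree_bound_pos by (simp add: tilt_def)
  also have "\<dots> \<le> f i / (1 - p)"
    using f_0_le[of i] p_le by (intro divide_right_mono) (auto simp: divide_le_eq)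
  finally show ?thesis .
qed

lemma tilt_f_0_ge: "ln (real n) * ln (p * real n) / 16 \<le> tilt * (f 0 * (p * real n) / 2)"
proof -
  define L y P where "L = ln (real n)" and "y = ln (p * real n)" and "P = p\<^sup>2 * real n"
  have L: "1 \<le> y" "y \<le> L" using ln_pn_ge ln_pn_le_ln_n by (auto simp: L_def y_def)
  have "4 * y * (L * P) \<le> 128 * L * (L * P)"
    using L by (intro mult_right_mono) (auto simp: P_def)
  then have "L * y / 16 * (4 * P + 128 * L) \<le> 8 * L\<^sup>2 * (y + P)"
    by (simp add: algebra_simps power2_eq_square)
  also have "\<dots> = (f 0)\<^sup>2 * (p * real n) / 2"
    using f_0_squared_mult_pn by (simp add: L_def y_def P_def)
  also have "4 * P + 128 * L = codegree_bound"
    by (simp add: codegree_bound_def L_def P_def)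
  finally have "L * y / 16 \<le> (f 0)\<^sup>2 * (p * real n) / 2 / codegree_bound"
    using codegree_bound_pos by (simp only: pos_le_divide_eq)
  then show ?thesis
    by (simp add: tilt_def L_def y_def power2_eq_square)
qed

lemma codegree_in_le_bound:
  assumes "u \<in> pverts G" "v \<in> pverts G" "u \<noteq> v"
  shows "real (codegree_in G S u v) \<le> codegree_bound"
proof -
  have "real (card (nbhd G u \<inter> nbhd G v)) \<le> codegree_bound"
    using typical assms by (auto simp: typical_def Let_def codegree_bound_def)
  then show ?thesis
    using codegree_in_le[of S u v] by linarith
qed

lemma card_nbhd_close:
  assumes "v \<in> pverts G"
  shows "\<bar>real (card (nbhd G v)) - p * real n\<bar> \<le> f 0 / 2 * (p * real n)"
proof -
  have "real (out_degree (with_proj G) v) \<in>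
      {(1 - f 0 / 2) * (p * real n)..(1 + f 0 / 2) * (p * real n)}"
    using typical assms unfolding typical_def Let_def by blast
  then show ?thesis
    unfolding mem_rel_interval_iff out_degree_eq_card_nbhd .
qed

lemma card_non_nbhd_close:
  assumes "S \<subseteq> pverts G" "real (card S) \<le> k"
  shows "\<bar>real (card (non_nbhd G S)) - (1 - p) ^ card S * real n\<bar> \<le>
    f (card S) * ((1 - p) ^ card S * real n)"
proof -
  have "real (card (non_nbhd G S)) \<in>
      {(1 - f (card S)) * ((1 - p) ^ card S * real n)..
       (1 + f (card S)) * ((1 - p) ^ card S * real n)}"
    using typical assms(1) order_trans[OF assms(2) k_le]
    by (simp only: typical_def Let_def simp_thms)
  then show ?thesis
    unfolding mem_rel_interval_iff .
qed

section \<open>Degrees and their drift\<close>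

definition degrees_in_windows :: "nat \<Rightarrow> 'a list \<Rightarrow> bool" where
  "degrees_in_windows i vs \<longleftrightarrow>
    (\<forall>v \<in> avail G vs i. \<bar>real (degree_in G (avail G vs i) v) - d i\<bar> \<le> f i * d i)"

text \<open>The sign \<open>s\<close> is \<open>1\<close> for the upper and \<open>-1\<close> for the lower end of the window.\<close>

definition excess :: "real \<Rightarrow> nat \<Rightarrow> real \<Rightarrow> real" where
  "excess s i x = (s * (x - d i) - f i * d i) / (1 - p) ^ i"

lemma excess_Suc_diff:
  "excess s (Suc i) (x - c) - excess s i x =
    (s * (p * x - c) - 17 * p * f i * d i) / (1 - p) ^ Suc i"
proof -
  define q where "q = 1 - p"
  have q: "q \<noteq> 0" using p_le by (simp add: q_def)
  have "excess s (Suc i) (x - c) - excess s i x =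
      (s * (x - c) - (s + f (Suc i)) * d (Suc i) - q * (s * x - (s + f i) * d i)) / q ^ Suc i"
    using q by (simp add: excess_def q_def[symmetric] field_simps)
  also have "d (Suc i) = q * d i"
    by (simp add: d_tilde_def q_def)
  also have "(s + f (Suc i)) * (q * d i) = (q * s + (1 + 16 * p) * f i) * d i"
    using q by (simp add: f_err_Suc q_def[symmetric] field_simps)
  finally show ?thesis
    by (simp add: q_def algebra_simps)
qed

lemma excess_pos_if_outside:
  assumes "f i * d i < \<bar>x - d i\<bar>"
  obtains s where "s \<in> {1, -1}" "0 < excess s i x"
proof
  show "sgn (x - d i) \<in> {1, -1}"
    using assms mult_pos_pos[OF f_pos d_pos, of i i] by (auto simp: sgn_if)
  show "0 < excess (sgn (x - d i)) i x"
    using assms p_le by (simp add: excess_def sgn_mult_self_eq abs_sgn mult.commute)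
qed

context
  fixes i :: nat and vs :: "'a list" and v :: 'a
  assumes i_le: "real i \<le> k" and run: "vs \<in> set_pmf (greedy_run G i)"
    and v_avail: "v \<in> avail G vs i" and in_windows: "degrees_in_windows i vs"
begin

lemma card_avail_close:
  "\<bar>real (card (avail G vs i)) - (1 - p) ^ i * real n\<bar> \<le> f i * ((1 - p) ^ i * real n)"
proof -
  have avail: "avail G vs i = non_nbhd G (set vs)"
    using length_greedy_run_le[OF pair_finite_verts run] by (simp add: avail_def)
  then have "set vs \<subseteq> pverts G" "card (set vs) = i"
    using greedy_run_invariant[OF pair_finite_verts run] v_avail by (auto simp: distinct_card)
  then show ?thesis
    using card_non_nbhd_close[of "set vs"] i_le by (simp add: avail)
qed

lemma sum_codegree_close:
  "\<bar>(\<Sum>u\<in>avail G vs i - {v}. real (codegree_in G (avail G vs i) u v)) -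
      real (degree_in G (avail G vs i) v) * d i\<bar>
    \<le> 2 * f i * (real (degree_in G (avail G vs i) v) * d i)"
proof -
  let ?V = "avail G vs i"
  have "\<bar>real (degree_in G ?V w - 1) - d i\<bar> \<le> 2 * (f i * d i)" if "w \<in> nbhd G v \<inter> ?V" for w
  proof -
    have "\<bar>real (degree_in G ?V w) - d i\<bar> \<le> f i * d i"
      using in_windows that by (simp add: degrees_in_windows_def)
    moreover have "\<bar>real (degree_in G ?V w - 1) - real (degree_in G ?V w)\<bar> \<le> 1"
      by simp
    ultimately show ?thesis
      using f_d_ge_one[of i] by linarith
  qed
  then have "\<bar>(\<Sum>w\<in>nbhd G v \<inter> ?V. real (degree_in G ?V w - 1)) - real (card (nbhd G v \<inter> ?V)) * d i\<bar>
      \<le> real (card (nbhd G v \<inter> ?V)) * (2 * (f i * d i))"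
    by (rule abs_sum_diff_const_le)
  moreover have "finite ?V"
    by (simp add: avail_def finite_non_nbhd)
  ultimately show ?thesis
    using sum_codegree_in[OF _ v_avail] degree_in_eq_card[OF v_avail]
    by (simp add: mult_ac flip: of_nat_sum)
qed

lemma mean_codegree_close:
  "\<bar>mean_codegree_in G (avail G vs i) v - p * real (degree_in G (avail G vs i) v)\<bar>
    \<le> 4 * f i * (p * real (degree_in G (avail G vs i) v))"
proof -
  let ?V = "avail G vs i" and ?N = "(1 - p) ^ i * real n"
  let ?X = "real (degree_in G ?V v)"
  have f: "0 < f i" "f i \<le> 1 / 20" using f_pos f_err_le i_le by auto
  have N: "0 < ?N" using p_le n_pos by simp
  have "\<bar>mean_codegree_in G ?V v - ?X * d i / ?N\<bar> \<le>
      (2 * f i + f i) / (1 - f i) * (?X * d i / ?N)"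
    unfolding mean_codegree_in_def
    using sum_codegree_close card_avail_close d_pos[of i] N f
    by (intro quotient_rel_error_le) auto
  also have "?X * d i / ?N = p * ?X"
    using p_le n_pos by (simp add: d_tilde_def card_gt_0_iff)
  also have "(2 * f i + f i) / (1 - f i) * (p * ?X) \<le> 4 * f i * (p * ?X)"
    using f p_pos by (intro mult_right_mono) (auto simp: field_simps power2_eq_square)
  finally show ?thesis .
qed

lemma mean_codegree_drift:
  "\<bar>mean_codegree_in G (avail G vs i) v - p * real (degree_in G (avail G vs i) v)\<bar> +
    f i / (1 - p) * mean_codegree_in G (avail G vs i) v \<le> 17 * p * f i * d i"
proof -
  let ?V = "avail G vs i"
  define Y A where "Y = p * real (degree_in G ?V v)" and "A = mean_codegree_in G ?V v"
  have f: "0 < f i" "f i \<le> 1 / 20" using f_pos f_err_le i_le by auto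
  have Y: "0 \<le> Y" using p_pos by (simp add: Y_def)
  have close: "\<bar>A - Y\<bar> \<le> 4 * f i * Y"
    using mean_codegree_close by (simp add: A_def Y_def)
  have "4 * f i * Y \<le> 1 * Y"
    using f Y by (intro mult_right_mono) auto
  then have A: "0 \<le> A" "A \<le> 2 * Y" using close by linarith+
  have "f i / (1 - p) \<le> 2 * f i"
    using f p_le p_pos by (simp add: field_simps mult_left_le)
  then have "f i / (1 - p) * A \<le> 2 * f i * (2 * Y)"
    using A f by (intro mult_mono) auto
  then have "\<bar>A - Y\<bar> + f i / (1 - p) * A \<le> 8 * f i * Y"
    using close by simp
  also have "\<dots> \<le> 8 * f i * (p * (2 * d i))"
  proof -
    have "real (degree_in G ?V v) - d i \<le> f i * d i"
      using in_windows v_avail by (auto simp: degrees_in_windows_def)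
    also have "\<dots> \<le> 1 * d i"
      using f d_pos[of i] by (intro mult_right_mono) auto
    finally show ?thesis
      unfolding Y_def using f p_pos by (intro mult_left_mono) auto
  qed
  also have "\<dots> \<le> 17 * p * f i * d i"
    using f p_pos d_pos[of i] by (simp add: mult_ac)
  finally show ?thesis by (simp add: A_def Y_def)
qed

lemma tilted_mean_codegree_le:
  assumes "\<bar>s\<bar> = 1" and b: "b \<le> f i / (1 - p)"
  shows "(b - s) * mean_codegree_in G (avail G vs i) v \<le>
    17 * p * f i * d i - s * p * real (degree_in G (avail G vs i) v)"
proof -
  let ?A = "mean_codegree_in G (avail G vs i) v" and ?Y = "p * real (degree_in G (avail G vs i) v)"
  have "s * (?Y - ?A) \<le> \<bar>?A - ?Y\<bar>"
    using abs_ge_self[of "s * (?Y - ?A)"] assms(1) by (simp add: abs_mult abs_minus_commute)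
  moreover have "b * ?A \<le> f i / (1 - p) * ?A"
    using b by (rule mult_right_mono) (simp add: mean_codegree_in_def sum_nonneg)
  ultimately show ?thesis
    using mean_codegree_drift by (simp add: algebra_simps)
qed

lemma sum_exp_excess_diff_le:
  assumes s: "\<bar>s\<bar> = 1"
  shows "(\<Sum>u\<in>avail G vs i - {v}. exp (tilt *
      (excess s (Suc i)
         (real (degree_in G (avail G vs i) v) - real (codegree_in G (avail G vs i) u v)) -
       excess s i (real (degree_in G (avail G vs i) v))))) \<le> real (card (avail G vs i))"
proof -
  let ?V = "avail G vs i"
  define X A where "X = real (degree_in G ?V v)" and "A = mean_codegree_in G ?V v"
  define c where "c u = real (codegree_in G ?V u v)" for u
  define H where "H = tilt / (1 - p) ^ Suc i"
  define b where "b = H * codegree_bound"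
  have H: "0 \<le> H" using tilt_pos p_le by (simp add: H_def)
  have b: "b \<le> f i / (1 - p)" using tilt_codegree_bound_le by (simp add: b_def H_def)
  have V: "finite ?V" "?V \<noteq> {}" using v_avail by (auto simp: avail_def finite_non_nbhd)
  have "(\<Sum>u\<in>?V - {v}. exp (H * (- s * c u - (17 * p * f i * d i - s * p * X)))) \<le> real (card ?V)"
  proof (rule sum_exp_tilted_le_card[where b = b])
    show "b \<le> 1"
      using b f_err_le[OF i_le] p_le by (elim order_trans) simp
    show "H * c u \<le> b" if "u \<in> ?V - {v}" for u
      unfolding b_def c_def using that v_avail avail_subset_pverts[of G vs i] H
      by (intro mult_left_mono codegree_in_le_bound) auto
    have "(b - s) * A \<le> 17 * p * f i * d i - s * p * X"
      unfolding A_def X_def using s b by (rule tilted_mean_codegree_le)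
    then have "real (card ?V) * ((b - s) * A) \<le>
        real (card ?V) * (17 * p * f i * d i - s * p * X)"
      by (rule mult_left_mono) simp
    also have "real (card ?V) * ((b - s) * A) = (b - s) * (\<Sum>u\<in>?V - {v}. c u)"
      using V by (simp add: A_def mean_codegree_in_def c_def)
    finally show "(b - s) * (\<Sum>u\<in>?V - {v}. c u) \<le>
        real (card ?V) * (17 * p * f i * d i - s * p * X)" .
  qed (use V H s in \<open>auto simp: c_def\<close>)
  moreover have "H * (- s * c u - (17 * p * f i * d i - s * p * X)) =
      tilt * (excess s (Suc i) (X - c u) - excess s i X)" for u
    unfolding excess_Suc_diff
    by (simp add: H_def algebra_simps diff_divide_distrib add_divide_distrib)
  ultimately show ?thesis
    by (simp add: X_def c_def)
qed

end

section \<open>The exponential potential\<close>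

definition tracked :: "'a \<Rightarrow> nat \<Rightarrow> 'a list \<Rightarrow> bool" where
  "tracked v i vs \<longleftrightarrow> v \<in> avail G vs i \<and> (\<forall>j<i. degrees_in_windows j vs)"

definition potential :: "real \<Rightarrow> 'a \<Rightarrow> nat \<Rightarrow> 'a list \<Rightarrow> real" where
  "potential s v i vs =
    (if tracked v i vs then exp (tilt * excess s i (real (degree_in G (avail G vs i) v))) else 0)"

definition first_failure :: "real \<Rightarrow> 'a \<Rightarrow> nat \<Rightarrow> 'a list set" where
  "first_failure s v i =
    {vs. tracked v i vs \<and> 0 < excess s i (real (degree_in G (avail G vs i) v))}"

lemma degrees_in_windows_cong:
  "take i us = take i vs \<Longrightarrow> degrees_in_windows i us \<longleftrightarrow> degrees_in_windows i vs"
  by (simp add: degrees_in_windows_def avail_def)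

lemma avail_append:
  "length vs = i \<Longrightarrow> avail G (vs @ [u]) (Suc i) = non_nbhd G (insert u (set vs))"
  by (simp add: avail_def)

lemma tracked_append:
  assumes "length vs = i"
  shows "tracked v (Suc i) (vs @ [u]) \<longleftrightarrow>
    tracked v i vs \<and> degrees_in_windows i vs \<and> v \<notin> insert u (nbhd G u)"
proof -
  have "degrees_in_windows j (vs @ [u]) \<longleftrightarrow> degrees_in_windows j vs" if "j < Suc i" for j
    using that assms by (intro degrees_in_windows_cong) simp
  moreover have "avail G vs i = non_nbhd G (set vs)"
    using assms by (simp add: avail_def)
  ultimately show ?thesis
    using assms by (auto simp: tracked_def avail_append non_nbhd_insert less_Suc_eq)
qed

lemma potential_nonneg: "0 \<le> potential s v i vs"
  by (simp add: potential_def)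

lemma potential_stopped:
  assumes "length vs \<le> i" "non_nbhd G (set vs) = {}"
  shows "potential s v i vs = 0"
  using assms by (simp add: potential_def tracked_def avail_def)

lemma potential_append_le:
  assumes "length vs = i"
  shows "potential s v (Suc i) (vs @ [u]) \<le> potential s v i vs *
    exp (tilt * (excess s (Suc i) (real (degree_in G (avail G vs i) v) -
      real (codegree_in G (avail G vs i) u v)) - excess s i (real (degree_in G (avail G vs i) v))))"
proof (cases "tracked v (Suc i) (vs @ [u])")
  case True
  have avail: "avail G vs i = non_nbhd G (set vs)"
    using assms by (simp add: avail_def)
  have "v \<in> non_nbhd G (insert u (set vs))"
    using True assms by (simp add: tracked_def avail_append)
  from degree_in_non_nbhd_insert[OF this]
  have "real (degree_in G (avail G vs i) v) - real (codegree_in G (avail G vs i) u v) =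
      real (degree_in G (avail G (vs @ [u]) (Suc i)) v)"
    using assms by (simp add: avail avail_append)
  then show ?thesis
    using True assms by (simp add: potential_def tracked_append algebra_simps flip: exp_add)
next
  case False
  then show ?thesis by (simp add: potential_def)
qed

lemma sum_potential_append_le:
  assumes s: "\<bar>s\<bar> = 1" and i: "real i \<le> k" and run: "vs \<in> set_pmf (greedy_run G i)"
  shows "(\<Sum>u\<in>non_nbhd G (set vs). potential s v (Suc i) (vs @ [u])) \<le>
    real (card (non_nbhd G (set vs))) * potential s v i vs"
proof (cases "tracked v i vs \<and> degrees_in_windows i vs")
  case True
  let ?V = "avail G vs i"
  have V: "?V = non_nbhd G (set vs)" "v \<in> ?V" "finite ?V"
    using True length_greedy_run_le[OF pair_finite_verts run]
    by (auto simp: avail_def tracked_def finite_non_nbhd)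
  then have len: "length vs = i"
    using greedy_run_invariant[OF pair_finite_verts run] by auto
  have "(\<Sum>u\<in>?V. potential s v (Suc i) (vs @ [u])) = (\<Sum>u\<in>?V - {v}. potential s v (Suc i) (vs @ [u]))"
    using V len by (subst sum.remove[of _ v]) (auto simp: potential_def tracked_append)
  also have "\<dots> \<le> potential s v i vs * (\<Sum>u\<in>?V - {v}. exp (tilt *
      (excess s (Suc i) (real (degree_in G ?V v) - real (codegree_in G ?V u v)) -
       excess s i (real (degree_in G ?V v)))))"
    unfolding sum_distrib_left using len by (intro sum_mono potential_append_le)
  also have "\<dots> \<le> potential s v i vs * real (card ?V)"
    using True V s i run
    by (intro mult_left_mono sum_exp_excess_diff_le potential_nonneg) auto
  finally show ?thesis
    by (simp add: V(1) mult.commute)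
next
  case False
  have "potential s v (Suc i) (vs @ [u]) = 0" if "u \<in> non_nbhd G (set vs)" for u
    using False that greedy_run_invariant[OF pair_finite_verts run]
    by (auto simp: potential_def tracked_append)
  then show ?thesis
    by (simp add: potential_nonneg)
qed

lemma potential_initial_le:
  assumes s: "\<bar>s\<bar> = 1"
  shows "potential s v 0 [] \<le> exp (- (tilt * (f 0 * (p * real n) / 2)))"
proof (cases "v \<in> pverts G")
  case True
  have avail: "avail G [] 0 = pverts G" by (simp add: avail_def non_nbhd_def)
  have degree: "degree_in G (pverts G) v = card (nbhd G v)"
    using True nbhd_subset_pverts by (simp add: degree_in_eq_card Int_absorb2)
  have "s * (real (card (nbhd G v)) - p * real n) \<le> \<bar>real (card (nbhd G v)) - p * real n\<bar>"
    using abs_ge_self[of "s * (real (card (nbhd G v)) - p * real n)"] s by (simp add: abs_mult)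
  then have "excess s 0 (real (card (nbhd G v))) \<le> - (f 0 * (p * real n) / 2)"
    using card_nbhd_close[OF True] by (simp add: excess_def d_tilde_def)
  then have "tilt * excess s 0 (real (card (nbhd G v))) \<le> tilt * - (f 0 * (p * real n) / 2)"
    using tilt_pos by (intro mult_left_mono) auto
  then show ?thesis
    by (simp add: potential_def avail degree)
next
  case False
  then show ?thesis by (simp add: potential_def tracked_def avail_def non_nbhd_def)
qed

lemma prob_first_failure_le:
  assumes "\<bar>s\<bar> = 1" and "real i \<le> k"
  shows "measure_pmf.prob (greedy_run G i) (first_failure s v i) \<le>
    exp (- (ln (real n) * ln (p * real n) / 16))"
proof -
  have "measure_pmf.prob (greedy_run G i) (first_failure s v i) \<le> potential s v 0 []"
  proof (rule prob_greedy_run_le_initial[OF pair_finite_verts potential_nonneg])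
    fix j vs assume j: "j < i" and run: "vs \<in> set_pmf (greedy_run G j)"
    show "potential s v (Suc j) vs \<le> potential s v j vs" if "non_nbhd G (set vs) = {}"
      using length_greedy_run_le[OF pair_finite_verts run] that by (simp add: potential_stopped)
    show "(\<Sum>u\<in>non_nbhd G (set vs). potential s v (Suc j) (vs @ [u])) \<le>
        real (card (non_nbhd G (set vs))) * potential s v j vs"
      using assms j run by (intro sum_potential_append_le) auto
  next
    show "1 \<le> potential s v i vs" if "vs \<in> first_failure s v i" for vs
      using that tilt_pos by (simp add: first_failure_def potential_def)
  qed
  also have "\<dots> \<le> exp (- (tilt * (f 0 * (p * real n) / 2)))"
    using assms(1) by (rule potential_initial_le)
  also have "\<dots> \<le> exp (- (ln (real n) * ln (p * real n) / 16))"
    using tilt_f_0_ge by simp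
  finally show ?thesis .
qed

lemma first_failure_if_not_in_windows:
  assumes "\<not> degrees_in_windows i vs"
  obtains j v s where "j \<le> i" "v \<in> pverts G" "s \<in> {1, -1}" "take j vs \<in> first_failure s v j"
proof -
  obtain j where j: "j \<le> i" "\<forall>j'<j. degrees_in_windows j' vs" "\<not> degrees_in_windows j vs"
    using ex_least_nat_le[of "\<lambda>i. \<not> degrees_in_windows i vs", OF assms] by blast
  then obtain v where v: "v \<in> avail G vs j"
    and outside: "f j * d j < \<bar>real (degree_in G (avail G vs j) v) - d j\<bar>"
    by (auto simp: degrees_in_windows_def not_le)
  obtain s where s: "s \<in> {1, -1}" "0 < excess s j (real (degree_in G (avail G vs j) v))"
    using excess_pos_if_outside[OF outside] .
  have "degrees_in_windows j' (take j vs)" if "j' < j" for j'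
    using j(2) that degrees_in_windows_cong[of j' "take j vs" vs] by (simp add: min_def)
  moreover have "avail G (take j vs) j = avail G vs j"
    by (simp add: avail_def)
  ultimately have "take j vs \<in> first_failure s v j"
    using v s(2) by (simp add: first_failure_def tracked_def)
  then show ?thesis
    using that j(1) v s(1) avail_subset_pverts[of G vs j] by blast
qed

lemma prob_take_first_failure_le:
  assumes "\<bar>s\<bar> = 1" and "real i \<le> k"
  shows "measure_pmf.prob (greedy_process G) (take i -` first_failure s v i) \<le>
    exp (- (ln (real n) * ln (p * real n) / 16))"
proof -
  have "i \<le> n" using assms(2) k_le_n by linarith
  then have "measure_pmf.prob (greedy_process G) (take i -` first_failure s v i) =
      measure_pmf.prob (greedy_run G i) (first_failure s v i)"
    unfolding greedy_process_def
    by (subst map_take_greedy_run[OF pair_finite_verts, symmetric]) simp_all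
  then show ?thesis
    using prob_first_failure_le[OF assms] by simp
qed

section \<open>The union bound\<close>

definition failure_indices :: "(nat \<times> 'a \<times> real) set" where
  "failure_indices = {i. real i \<le> k} \<times> pverts G \<times> {1, -1}"

lemma times_up_to_k_subset: "{i. real i \<le> k} \<subseteq> {..n}"
  using k_le_n by auto

lemma finite_failure_indices: "finite failure_indices"
  using finite_subset[OF times_up_to_k_subset] by (simp add: failure_indices_def)

lemma card_failure_indices_le: "card failure_indices \<le> 4 * n\<^sup>2"
proof -
  have "card failure_indices = card {i. real i \<le> k} * (n * 2)"
    by (simp add: failure_indices_def card_cartesian_product)
  also have "\<dots> \<le> (n + 1) * (n * 2)"
    using card_mono[OF _ times_up_to_k_subset] by (intro mult_right_mono) simp_all
  also have "\<dots> \<le> 4 * n\<^sup>2"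
    using n_pos by (simp add: power2_eq_square)
  finally show ?thesis .
qed

lemma prob_degrees_in_windows_ge:
  "1 - 4 * (real n)\<^sup>2 * exp (- (ln (real n) * ln (p * real n) / 16)) \<le>
    measure_pmf.prob (greedy_process G) {vs. \<forall>i. real i \<le> k \<longrightarrow> degrees_in_windows i vs}"
proof -
  let ?\<delta> = "exp (- (ln (real n) * ln (p * real n) / 16))"
  let ?good = "{vs. \<forall>i. real i \<le> k \<longrightarrow> degrees_in_windows i vs}"
  let ?failures = "\<Union>(i, v, s)\<in>failure_indices. take i -` first_failure s v i"
  have "- ?good \<subseteq> ?failures"
  proof
    fix vs assume "vs \<in> - ?good"
    then obtain i where i: "real i \<le> k" "\<not> degrees_in_windows i vs" by auto
    obtain j v s where "j \<le> i" "v \<in> pverts G" "s \<in> {1, -1}" "take j vs \<in> first_failure s v j"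
      using first_failure_if_not_in_windows[OF i(2)] .
    moreover from this i(1) have "real j \<le> k" by linarith
    ultimately have "(j, v, s) \<in> failure_indices" "vs \<in> take j -` first_failure s v j"
      by (auto simp: failure_indices_def)
    then show "vs \<in> ?failures" by blast
  qed
  then have "measure_pmf.prob (greedy_process G) (- ?good) \<le>
      measure_pmf.prob (greedy_process G) ?failures"
    by (rule measure_pmf.finite_measure_mono) simp
  also have "\<dots> \<le> (\<Sum>(i, v, s)\<in>failure_indices.
      measure_pmf.prob (greedy_process G) (take i -` first_failure s v i))"
    unfolding case_prod_unfold by (intro measure_UNION_le finite_failure_indices) simp
  also have "\<dots> \<le> real (card failure_indices) * ?\<delta>"
    by (rule sum_bounded_above)
      (auto simp: failure_indices_def intro: prob_take_first_failure_le)
  also have "\<dots> \<le> real (4 * n\<^sup>2) * ?\<delta>"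
    by (intro mult_right_mono of_nat_mono card_failure_indices_le) simp
  finally show ?thesis
    using measure_pmf.prob_compl[of ?good "greedy_process G"] by (simp add: Compl_eq_Diff_UNIV)
qed

end

section \<open>Asymptotics\<close>

lemma growth_factor_power_le_powr:
  fixes p x \<delta> :: real
  assumes p: "0 < p" "p \<le> 1 / 18" and x: "0 < x" and i: "real i \<le> \<delta> * inverse p * ln x"
  shows "((1 + 16 * p) / (1 - p)) ^ i \<le> x powr (18 * \<delta>)"
proof -
  have "(1 + 16 * p) / (1 - p) \<le> 1 + 18 * p"
    using p by (simp add: field_simps)
  also have "\<dots> \<le> exp (18 * p)"
    by (rule exp_ge_add_one_self)
  finally have "((1 + 16 * p) / (1 - p)) ^ i \<le> exp (18 * p) ^ i"
    using p by (intro power_mono) auto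
  also have "\<dots> = exp (18 * p * real i)"
    by (simp add: exp_of_nat_mult[symmetric] mult_ac)
  also have "\<dots> \<le> exp (18 * p * (\<delta> * inverse p * ln x))"
    using i p by simp
  also have "\<dots> = x powr (18 * \<delta>)"
    using p x by (simp add: powr_def)
  finally show ?thesis .
qed

lemma f_err_le_powr:
  fixes p \<delta> :: real
  assumes p: "0 < p" "p \<le> 1 / 18" and x: "1 \<le> p * real n" and n: "1 \<le> n"
    and i: "real i \<le> \<delta> * inverse p * ln (p * real n)"
  shows "f_err n p i \<le> 4 * ln (real n) * (p * real n) powr (18 * \<delta>) *
    (sqrt (ln (p * real n) / (p * real n)) + sqrt p)"
proof -
  have "((1 + 16 * p) / (1 - p)) ^ i \<le> (p * real n) powr (18 * \<delta>)"
    using p x i by (intro growth_factor_power_le_powr) auto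
  moreover have "sqrt (ln (p * real n) / (p * real n) + p) \<le>
      sqrt (ln (p * real n) / (p * real n)) + sqrt p"
    using x p by (intro sqrt_add_le_add_sqrt) auto
  ultimately have "f_err n p i \<le> (p * real n) powr (18 * \<delta>) *
      (4 * ln (real n) * (sqrt (ln (p * real n) / (p * real n)) + sqrt p))"
    unfolding f_err_def using n p x by (intro mult_mono) auto
  then show ?thesis by (simp only: mult_ac)
qed

context
  fixes \<epsilon> :: real and p :: "nat \<Rightarrow> real"
  assumes eps: "0 < \<epsilon>"
    and density: "\<forall>\<^sub>F n in sequentially.
      ln (real n) powr (2 + \<epsilon>) * inverse (real n) \<le> p n \<and> p n < real n powr (- \<epsilon>)"
begin

lemma eventually_pn_ge: "\<forall>\<^sub>F n in sequentially. ln (real n) powr (2 + \<epsilon>) \<le> p n * real n"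
  using density eventually_gt_at_top[of 0]
  by eventually_elim (auto simp: field_simps)

lemma filterlim_pn_at_top: "filterlim (\<lambda>n. p n * real n) at_top sequentially"
proof (rule filterlim_at_top_mono[OF _ eventually_pn_ge])
  show "filterlim (\<lambda>n. ln (real n) powr (2 + \<epsilon>)) at_top sequentially"
    using eps by real_asymp
qed

lemma eventually_p_bounds:
  assumes "0 < c"
  shows "\<forall>\<^sub>F n in sequentially. 0 < p n \<and> p n \<le> c"
proof -
  have "\<forall>\<^sub>F n in sequentially. real n powr (- \<epsilon>) \<le> c"
    using eps assms by real_asymp
  moreover have "\<forall>\<^sub>F n in sequentially. 0 < p n * real n"
    using filterlim_pn_at_top by (simp add: filterlim_at_top_dense)
  ultimately show ?thesis
    using density by eventually_elim (auto simp: zero_less_mult_iff)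
qed

lemma eventually_sqrt_ln_term_le:
  assumes "18 * \<delta> < \<epsilon> / (2 * (2 + \<epsilon>))" "0 < c"
  shows "\<forall>\<^sub>F n in sequentially.
    ln (real n) * (p n * real n) powr (18 * \<delta>) * sqrt (ln (p n * real n) / (p n * real n)) \<le> c"
proof -
  define a where "a = 1 / (2 + \<epsilon>) + 18 * \<delta>"
  have "1 / 2 - 1 / (2 + \<epsilon>) = \<epsilon> / (2 * (2 + \<epsilon>))"
    using eps by (simp add: field_simps)
  then have "a < 1 / 2"
    using assms(1) unfolding a_def by linarith
  then have "\<forall>\<^sub>F x in at_top. x powr a * sqrt (ln x / x) \<le> c"
    using assms(2) by real_asymp
  then have "\<forall>\<^sub>F n in sequentially.
      (p n * real n) powr a * sqrt (ln (p n * real n) / (p n * real n)) \<le> c"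
    using filterlim_pn_at_top by (rule eventually_compose_filterlim)
  moreover have "\<forall>\<^sub>F n in sequentially. 1 \<le> p n * real n"
    using filterlim_pn_at_top by (simp add: filterlim_at_top)
  ultimately show ?thesis
    using eventually_pn_ge eventually_ge_at_top[of 1]
  proof eventually_elim
    case (elim n)
    have "ln (real n) = (ln (real n) powr (2 + \<epsilon>)) powr (1 / (2 + \<epsilon>))"
      using elim eps by (simp add: powr_powr)
    also have "\<dots> \<le> (p n * real n) powr (1 / (2 + \<epsilon>))"
      using elim eps by (intro powr_mono2) auto
    finally have "ln (real n) * (p n * real n) powr (18 * \<delta>) \<le> (p n * real n) powr a"
      by (simp add: a_def powr_add mult_right_mono)
    then have "ln (real n) * (p n * real n) powr (18 * \<delta>) *
        sqrt (ln (p n * real n) / (p n * real n)) \<le>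
        (p n * real n) powr a * sqrt (ln (p n * real n) / (p n * real n))"
      using elim by (intro mult_right_mono) auto
    then show ?case using elim by linarith
  qed
qed

lemma eventually_sqrt_p_term_le:
  assumes "0 \<le> \<delta>" "18 * \<delta> < \<epsilon> / (2 * (2 + \<epsilon>))" "0 < c"
  shows "\<forall>\<^sub>F n in sequentially. ln (real n) * (p n * real n) powr (18 * \<delta>) * sqrt (p n) \<le> c"
proof -
  have "\<epsilon> / (2 * (2 + \<epsilon>)) \<le> \<epsilon> / 2"
    using eps by (intro divide_left_mono) auto
  then have "18 * \<delta> - \<epsilon> / 2 < 0"
    using assms(2) by linarith
  then have "\<forall>\<^sub>F n in sequentially. ln (real n) * real n powr (18 * \<delta> - \<epsilon> / 2) \<le> c"
    using assms(3) by real_asymp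
  then show ?thesis
    using density eventually_p_bounds[of 1, OF zero_less_one] eventually_ge_at_top[of 1]
  proof eventually_elim
    case (elim n)
    have "p n * real n \<le> 1 * real n"
      using elim by (intro mult_right_mono) auto
    then have "(p n * real n) powr (18 * \<delta>) \<le> real n powr (18 * \<delta>)"
      using elim assms(1) by (intro powr_mono2) auto
    moreover have "sqrt (p n) \<le> sqrt (real n powr (- \<epsilon>))"
      using elim by simp
    moreover have "\<dots> = real n powr (- \<epsilon> / 2)"
      by (simp add: powr_half_sqrt[symmetric] powr_powr)
    ultimately have "ln (real n) * (p n * real n) powr (18 * \<delta>) * sqrt (p n) \<le>
        ln (real n) * real n powr (18 * \<delta>) * real n powr (- \<epsilon> / 2)"
      using elim by (intro mult_mono) auto
    also have "\<dots> = ln (real n) * real n powr (18 * \<delta> - \<epsilon> / 2)"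
      using powr_add[of "real n" "18 * \<delta>" "- \<epsilon> / 2"] by simp
    finally show ?case using elim by linarith
  qed
qed

lemma eventually_f_err_le:
  assumes "0 \<le> \<delta>" "18 * \<delta> < \<epsilon> / (2 * (2 + \<epsilon>))" "0 < c"
  shows "\<forall>\<^sub>F n in sequentially. \<forall>i. real i \<le> \<delta> * inverse (p n) * ln (p n * real n) \<longrightarrow>
    f_err n (p n) i \<le> c"
proof -
  have c: "0 < c / 8"
    using assms(3) by simp
  have "\<forall>\<^sub>F n in sequentially. 1 \<le> p n * real n"
    using filterlim_pn_at_top by (simp add: filterlim_at_top)
  moreover have "\<forall>\<^sub>F n in sequentially. 0 < p n \<and> p n \<le> 1 / 18"
    by (rule eventually_p_bounds) simp
  ultimately show ?thesis
    using eventually_sqrt_ln_term_le[OF assms(2) c] eventually_sqrt_p_term_le[OF assms(1,2) c]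
      eventually_ge_at_top[of 1]
  proof eventually_elim
    case (elim n)
    show ?case
    proof (intro allI impI)
      fix i assume "real i \<le> \<delta> * inverse (p n) * ln (p n * real n)"
      then have "f_err n (p n) i \<le> 4 * ln (real n) * (p n * real n) powr (18 * \<delta>) *
          (sqrt (ln (p n * real n) / (p n * real n)) + sqrt (p n))"
        using elim by (intro f_err_le_powr) auto
      also have "\<dots> \<le> c"
        using elim by (simp add: algebra_simps)
      finally show "f_err n (p n) i \<le> c" .
    qed
  qed
qed

lemma eventually_ln_pn_ge: "\<forall>\<^sub>F n in sequentially. c \<le> ln (p n * real n)"
  using filterlim_compose[OF ln_at_top filterlim_pn_at_top] by (simp add: filterlim_at_top)

lemma eventually_typical_process:
  assumes "\<epsilon> \<le> 1" "0 \<le> \<delta>" "\<delta> \<le> \<epsilon>" "18 * \<delta> < \<epsilon> / (2 * (2 + \<epsilon>))"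
  shows "\<forall>\<^sub>F n in sequentially. \<forall>G :: 'a pair_pre_digraph.
    pair_graph G \<and> card (pverts G) = n \<and> typical \<epsilon> (p n) G \<longrightarrow>
    typical_process G \<epsilon> (p n) (\<delta> * inverse (p n) * ln (p n * real n))"
proof -
  have "\<forall>\<^sub>F n in sequentially. \<forall>i. real i \<le> \<delta> * inverse (p n) * ln (p n * real n) \<longrightarrow>
      f_err n (p n) i \<le> 1 / 20"
    using assms(2,4) by (rule eventually_f_err_le) simp
  moreover have "\<forall>\<^sub>F n in sequentially. 0 < p n \<and> p n \<le> 1 / 100"
    by (rule eventually_p_bounds) simp
  ultimately show ?thesis
    using eventually_ln_pn_ge[of 1]
  proof eventually_elim
    case (elim n)
    have "\<delta> * inverse (p n) * ln (p n * real n) \<le> \<epsilon> * inverse (p n) * ln (p n * real n)"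
      using elim assms(3) by (intro mult_right_mono) auto
    then show ?case
      using elim assms(1) by (auto intro!: typical_process.intro typical_process_axioms.intro)
  qed
qed

end

lemma union_bound_le_powr:
  assumes "2 \<le> n" "100 \<le> y"
  shows "4 * (real n)\<^sup>2 * exp (- (ln (real n) * y / 16)) \<le> real n powr (- (1 / 2 ^ 11) * y)"
proof -
  have "4 * (real n)\<^sup>2 \<le> (real n)\<^sup>2 * (real n)\<^sup>2"
    using power_mono[of 2 "real n" 2] assms(1) by (intro mult_right_mono) auto
  also have "\<dots> = real n powr 4"
    using assms(1) by (simp flip: powr_numeral powr_add)
  finally have "4 * (real n)\<^sup>2 * exp (- (ln (real n) * y / 16)) \<le>
      real n powr 4 * exp (- (ln (real n) * y / 16))"
    by (rule mult_right_mono) simp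
  also have "\<dots> = real n powr 4 * real n powr (- (y / 16))"
    using assms(1) by (simp add: powr_def mult_ac)
  also have "\<dots> \<le> real n powr (- (1 / 2 ^ 11) * y)"
    unfolding powr_add[symmetric] using assms by (intro powr_mono) auto
  finally show ?thesis .
qed

lemma (in typical_process) prob_degrees_in_windows_ge_powr:
  assumes "2 \<le> n" "100 \<le> ln (p * real n)"
  shows "1 - real n powr (- (1 / 2 ^ 11) * ln (p * real n)) \<le>
    measure_pmf.prob (greedy_process G) {vs. \<forall>i. real i \<le> k \<longrightarrow> degrees_in_windows i vs}"
  using prob_degrees_in_windows_ge union_bound_le_powr[OF assms] by linarith

theorem theorem3p1:
  fixes \<epsilon> :: real and p :: "nat \<Rightarrow> real"
  assumes "0 < \<epsilon>" and "\<epsilon> < 1 / 2 ^ 10"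
    and "\<forall>\<^sub>F n in sequentially.
           ln (real n) powr (2 + \<epsilon>) * inverse (real n) \<le> p n \<and> p n < real n powr (- \<epsilon>)"
  shows "\<forall>\<^sub>F n in sequentially. \<forall>G :: 'a pair_pre_digraph.
           pair_graph G \<and> card (pverts G) = n \<and> typical \<epsilon> (p n) G \<longrightarrow>
           (let k = \<epsilon> * (1 / 2 ^ 10) * inverse (p n) * ln (p n * real n) in
            measure_pmf.prob (greedy_process G)
              {vs. \<forall>i \<ge> 1. real i \<le> k - 1 \<longrightarrow>
                 (\<forall>v \<in> avail G vs i. real (degree_in G (avail G vs i) v) \<in>
                    {(1 - f_err n (p n) i) * d_tilde n (p n) i ..
                     (1 + f_err n (p n) i) * d_tilde n (p n) i})}
            \<ge> 1 - real n powr (- (1 / 2 ^ 11) * ln (p n * real n)))"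
proof -
  have "18 * (\<epsilon> * (1 / 2 ^ 10)) < \<epsilon> / (2 * (2 + \<epsilon>))"
    using assms(1,2) by (simp add: field_simps)
  then have "\<forall>\<^sub>F n in sequentially. \<forall>G :: 'a pair_pre_digraph.
      pair_graph G \<and> card (pverts G) = n \<and> typical \<epsilon> (p n) G \<longrightarrow>
      typical_process G \<epsilon> (p n) (\<epsilon> * (1 / 2 ^ 10) * inverse (p n) * ln (p n * real n))"
    using assms(1,2) by (intro eventually_typical_process[OF assms(1,3)]) auto
  then show ?thesis
    using eventually_ln_pn_ge[OF assms(1,3), of 100] eventually_ge_at_top[of 2]
  proof eventually_elim
    case (elim n)
    let ?k = "\<epsilon> * (1 / 2 ^ 10) * inverse (p n) * ln (p n * real n)"
    show ?case
    proof (intro allI impI, goal_cases)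
      case (1 G)
      then interpret typical_process G \<epsilon> "p n" ?k
        using elim by blast
      have "1 - real n powr (- (1 / 2 ^ 11) * ln (p n * real n)) \<le>
          measure_pmf.prob (greedy_process G) {vs. \<forall>i. real i \<le> ?k \<longrightarrow> degrees_in_windows i vs}"
        using prob_degrees_in_windows_ge_powr elim 1 by simp
      also have "\<dots> \<le> measure_pmf.prob (greedy_process G)
          {vs. \<forall>i \<ge> 1. real i \<le> ?k - 1 \<longrightarrow> degrees_in_windows i vs}"
        by (intro measure_pmf.finite_measure_mono) auto
      finally show ?case
        using 1 by (simp only: Let_def degrees_in_windows_def mem_rel_interval_iff)
    qed
  qed
qed

end
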